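(* (1) For every $\alpha\in(0,1]$, $\mathrm{ES}_\alpha=\min\{\rho:L^1\to\overline{\mathbb{R}}\mid\rho\ge\mathrm{VaR}_\alpha\text{ and }\rho\text{ is quasi-convex and law invariant}\}$. (2) For every $\alpha\in(0,1)$, $\mathrm{ES}_\alpha=\min\{\rho:L^1\to\overline{\mathbb{R}}\mid\rho\ge\mathrm{VaR}^+_\alpha\text{ and }\rho\text{ is quasi-convex and law invariant}\}$. (3) For every $\alpha\in[0,1)$, $\mathrm{ES}_\alpha=\min\{\rho:\underline{L}^1\to\overline{\mathbb{R}}\mid\rho\ge\mathrm{VaR}^+_\alpha\text{ and }\rho\text{ is quasi-convex and law invariant}\}$ (with $\mathrm{ES}_\alpha$ restricted to $\underline{L}^1$). Here "min" means that $\mathrm{ES}_\alpha$ belongs to the set and is pointwise $\le$ every element of it.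
   Context: $(\Omega,\mathcal F,\mathbb P)$ is an atomless probability space, $L^0$ all random variables, $L^1$ integrable ones, $\underline{L}^1$ the elements of $L^1$ that are essentially bounded from below; $\overline{\mathbb{R}}=[-\infty,\infty]$. For $\alpha\in[0,1]$, $X\in L^0$: $\mathrm{VaR}_\alpha(X)=\inf\{x\in\mathbb{R}:\mathbb P(X\le x)\ge\alpha\}$, $\mathrm{VaR}^+_\alpha(X)=\inf\{x\in\mathbb{R}:\mathbb P(X\le x)>\alpha\}$ ($\inf\mathbb{R}=-\infty$, $\inf\emptyset=\infty$). For $X\in L^1$: $\mathrm{ES}_\alpha(X)=\frac{1}{1-\alpha}\int_\alpha^1\mathrm{VaR}_\beta(X)\,\mathrm d\beta$ for $\alpha\in[0,1)$, $\mathrm{ES}_1(X)=\mathrm{VaR}_1(X)$ (values in $(-\infty,\infty]$). A map $\rho$ on a set $\mathcal X$ of random variables is quasi-convex if $\rho(\gamma X+(1-\gamma)Y)\le\max\{\rho(X),\rho(Y)\}$ for all $X,Y\in\mathcal X$, $\gamma\in[0,1]$, and law invariant if $\rho(X)=\rho(Y)$ for equally distributed $X,Y$. $\rho\ge\widetilde\rho$ means pointwise inequality on the common domain. *)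

theory Defs
  imports "HOL-Probability.Probability"
begin

definition atomless :: "'a measure \<Rightarrow> bool" where
  "atomless M \<longleftrightarrow> (\<forall>A\<in>sets M. measure M A > 0 \<longrightarrow>
      (\<exists>B\<in>sets M. B \<subseteq> A \<and> 0 < measure M B \<and> measure M B < measure M A))"

definition L1 :: "'a measure \<Rightarrow> ('a \<Rightarrow> real) set" where
  "L1 M = {X. integrable M X}"

definition L1_bdd_below :: "'a measure \<Rightarrow> ('a \<Rightarrow> real) set" where
  "L1_bdd_below M = {X. integrable M X \<and> (\<exists>c::real. AE \<omega> in M. c \<le> X \<omega>)}"

definition VaR :: "'a measure \<Rightarrow> real \<Rightarrow> ('a \<Rightarrow> real) \<Rightarrow> ereal" where
  "VaR M \<alpha> X = Inf {ereal x | x. measure M {\<omega>\<in>space M. X \<omega> \<le> x} \<ge> \<alpha>}"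

definition VaR_plus :: "'a measure \<Rightarrow> real \<Rightarrow> ('a \<Rightarrow> real) \<Rightarrow> ereal" where
  "VaR_plus M \<alpha> X = Inf {ereal x | x. measure M {\<omega>\<in>space M. X \<omega> \<le> x} > \<alpha>}"

text \<open>Expected shortfall; for integrable X and \<alpha> < 1 the quantile function is finite
  on (\<alpha>,1) and integrable there.\<close>
definition ES :: "'a measure \<Rightarrow> real \<Rightarrow> ('a \<Rightarrow> real) \<Rightarrow> ereal" where
  "ES M \<alpha> X = (if \<alpha> < 1
     then ereal ((LBINT \<beta>:{\<alpha><..<1}. real_of_ereal (VaR M \<beta> X)) / (1 - \<alpha>))
     else VaR M 1 X)"

definition quasi_convex_on :: "('a \<Rightarrow> real) set \<Rightarrow> (('a \<Rightarrow> real) \<Rightarrow> ereal) \<Rightarrow> bool" where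
  "quasi_convex_on D \<rho> \<longleftrightarrow> (\<forall>X\<in>D. \<forall>Y\<in>D. \<forall>\<gamma>::real. 0 \<le> \<gamma> \<and> \<gamma> \<le> 1 \<longrightarrow>
      \<rho> (\<lambda>\<omega>. \<gamma> * X \<omega> + (1 - \<gamma>) * Y \<omega>) \<le> max (\<rho> X) (\<rho> Y))"

definition law_invariant_on :: "'a measure \<Rightarrow> ('a \<Rightarrow> real) set \<Rightarrow> (('a \<Rightarrow> real) \<Rightarrow> ereal) \<Rightarrow> bool" where
  "law_invariant_on M D \<rho> \<longleftrightarrow> (\<forall>X\<in>D. \<forall>Y\<in>D. distr M borel X = distr M borel Y \<longrightarrow> \<rho> X = \<rho> Y)"

definition dominating_qc_li :: "'a measure \<Rightarrow> ('a \<Rightarrow> real) set \<Rightarrow> (('a \<Rightarrow> real) \<Rightarrow> ereal)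
     \<Rightarrow> (('a \<Rightarrow> real) \<Rightarrow> ereal) set" where
  "dominating_qc_li M D g = {\<rho>. (\<forall>X\<in>D. g X \<le> \<rho> X) \<and> quasi_convex_on D \<rho> \<and> law_invariant_on M D \<rho>}"

definition is_min_on :: "('a \<Rightarrow> real) set \<Rightarrow> (('a \<Rightarrow> real) \<Rightarrow> ereal) \<Rightarrow> (('a \<Rightarrow> real) \<Rightarrow> ereal) set \<Rightarrow> bool" where
  "is_min_on D f S \<longleftrightarrow> f \<in> S \<and> (\<forall>\<rho>\<in>S. \<forall>X\<in>D. f X \<le> \<rho> X)"

end

(*
  Minimality. Let q be the quantile function of X and U a uniform random variable. Cut (a,1) into n
  intervals of length h and let T rotate them cyclically, fixing (0,a]. The variables q (T^i U), i < n,
  have the law of X, so quasi-convexity and law invariance bound rho of their average by rho X. On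
  {U > a} the orbit of U meets each interval exactly once, so there the average is at least a lower
  Riemann sum of q over (a,1), divided by 1 - a. As P (U > a) = 1 - a, the upper quantile at level a
  of the average is at least this sum, which tends to the expected shortfall. For the lower quantile
  one applies this at levels b < a and lets b tend to a.

  Membership. Quasi-convexity of the expected shortfall comes from convexity, which follows from the
  Rockafellar-Uryasev formula (1 - a) * ES_a X = min_x ((1 - a) * x + E (max 0 (X - x))).
*)

theory Submission
  imports Defs
begin

text \<open>For u in (a, 1] this is translation by \<open>h\<close> modulo the length
  \<open>1 - a\<close>, since \<open>u - (1 - a - h)\<close> is \<open>u + h - (1 - a)\<close>.
  Half-open pieces match the events \<open>U \<omega> \<le> t\<close> that describe a distribution
  function.\<close>

definition cyclic_shift :: "real \<Rightarrow> real \<Rightarrow> real \<Rightarrow> real" where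
  "cyclic_shift a h u = (if u \<le> a then u else if u \<le> 1 - h then u + h else u - (1 - a - h))"

lemma measurable_cyclic_shift [measurable]: "cyclic_shift a h \<in> borel_measurable borel"
  unfolding cyclic_shift_def by measurable

text \<open>With \<open>h = (1 - a) / n\<close>, the \<open>i\<close>-th iterate carries the \<open>k\<close>-th of the \<open>n\<close> subintervals of
  \<open>(a, 1]\<close> to the one with index \<open>k + i\<close> modulo \<open>n\<close>.\<close>
lemma funpow_cyclic_shift:
  fixes n k :: nat and a h u :: real
  assumes h: "0 < h" "real n * h = 1 - a" and "k < n" "a + k * h < u" "u \<le> a + (k + 1) * h"
  defines "l \<equiv> \<lambda>i. (k + i) mod n"
  shows "a + l i * h < (cyclic_shift a h ^^ i) u \<and> (cyclic_shift a h ^^ i) u \<le> a + (l i + 1) * h"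
proof (induction i)
  case 0
  then show ?case using assms by (simp add: algebra_simps)
next
  case (Suc i)
  define v where "v = (cyclic_shift a h ^^ i) u"
  have ln: "l i < n" using assms by (simp add: l_def)
  have v: "a + l i * h < v" "v \<le> a + (l i + 1) * h" using Suc by (simp_all add: v_def algebra_simps)
  have "0 \<le> l i * h" using h by simp
  then have va: "a < v" using v by simp
  have S: "(cyclic_shift a h ^^ Suc i) u = cyclic_shift a h v" by (simp add: v_def)
  show ?case
  proof (cases "Suc (l i) < n")
    case True
    then have l: "l (Suc i) = Suc (l i)" by (simp add: l_def mod_Suc)
    \<comment> \<open>Interval \<open>l i\<close> is not the last one, so its right end is at most
      \<open>1 - h\<close> and the shift acts as plain translation. In the other case its left end
      is \<open>1 - h\<close>, and the shift wraps around to the first interval.\<close>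
    have "(l i + 2) * h \<le> n * h" using True h by (intro mult_right_mono) auto
    then have "v \<le> 1 - h" using v h by (simp add: algebra_simps)
    then show ?thesis using v va l unfolding S by (simp add: cyclic_shift_def algebra_simps)
  next
    case False
    with ln have n: "n = Suc (l i)" by simp
    then have l: "l (Suc i) = 0" by (simp add: l_def mod_Suc)
    have nh: "(l i + 1) * h = 1 - a" using h n by simp
    then have "1 - h < v" using v by (simp add: algebra_simps)
    then show ?thesis using v va l nh unfolding S by (simp add: cyclic_shift_def algebra_simps)
  qed
qed

context prob_space
begin

subsection \<open>Uniform random variables on atomless spaces\<close>

text \<open>Repeated halving: if \<open>C\<close> is a part of \<open>B\<close> of strictly smaller
  positive probability, then one of \<open>C\<close> and \<open>B - C\<close> has at most half the
  probability of \<open>B\<close>, and both are non-null.\<close>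

lemma atomless_small_subset:
  assumes "atomless M" "A \<in> events" "0 < prob A" "0 < e"
  obtains B where "B \<in> events" "B \<subseteq> A" "0 < prob B" "prob B < e"
proof -
  have halve: "\<exists>B\<in>events. B \<subseteq> A \<and> 0 < prob B \<and> prob B \<le> prob A / 2 ^ n" for n
  proof (induction n)
    case 0
    then show ?case using assms by auto
  next
    case (Suc n)
    then obtain B where B: "B \<in> events" "B \<subseteq> A" "0 < prob B" "prob B \<le> prob A / 2 ^ n" by auto
    then obtain C where C: "C \<in> events" "C \<subseteq> B" "0 < prob C" "prob C < prob B"
      using assms(1) unfolding atomless_def by blast
    have d: "prob (B - C) = prob B - prob C" using B C by (simp add: finite_measure_Diff)
    show ?case
    proof (cases "prob C \<le> prob B / 2")
      case True
      then show ?thesis using B C by (intro bexI[of _ C]) auto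
    next
      case False
      then show ?thesis using B C d by (intro bexI[of _ "B - C"]) auto
    qed
  qed
  obtain n where "prob A / e < 2 ^ n" using real_arch_pow[of 2 "prob A / e"] by auto
  then have "prob A / 2 ^ n < e" using assms(4) by (simp add: field_simps)
  with halve[of n] that show thesis by (meson le_less_trans)
qed

text \<open>Sierpinski's theorem, by exhaustion: if the union \<open>B\<close> of a greedily chosen
  increasing sequence fell short of \<open>t\<close>, a small piece of \<open>A - B\<close> could
  have been added at every stage.\<close>

lemma atomless_exact_subset:
  assumes "atomless M" "A \<in> events" "0 \<le> t" "t \<le> prob A"
  obtains B where "B \<in> events" "B \<subseteq> A" "prob B = t"
proof -
  \<comment> \<open>\<open>adm C D\<close>: the set \<open>D\<close> enlarges \<open>C\<close>
    within \<open>A\<close> and within the budget \<open>t\<close>. So \<open>adm C C\<close> says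
    that \<open>C\<close> is itself a legitimate stage, and \<open>s C\<close> is the supremum
    reachable from it.\<close>
  define adm where "adm C D \<longleftrightarrow> D \<in> events \<and> C \<subseteq> D \<and> D \<subseteq> A \<and> prob D \<le> t" for C D
  define s where "s C = (SUP D\<in>{D. adm C D}. prob D)" for C
  have bdd: "bdd_above (prob ` {D. adm C D})" for C by (rule bdd_aboveI[of _ t]) (auto simp: adm_def)
  \<comment> \<open>Exhaust greedily, each time gaining at least half of the largest possible increase.\<close>
  have step: "\<exists>D. adm C D \<and> prob D \<ge> (prob C + s C) / 2" if "adm C C" for C
  proof (cases "prob C < s C")
    case True
    then have "(prob C + s C) / 2 < s C" by simp
    moreover have "{D. adm C D} \<noteq> {}" using that by auto
    ultimately have "\<exists>D\<in>{D. adm C D}. (prob C + s C) / 2 < prob D"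
      using less_cSUP_iff[OF _ bdd, of C "(prob C + s C) / 2"] unfolding s_def by simp
    then obtain D where "adm C D" "(prob C + s C) / 2 < prob D" by auto
    then show ?thesis by (intro exI[of _ D]) auto
  next
    case False
    then show ?thesis using that by (intro exI[of _ C]) auto
  qed
  then obtain f where f: "\<And>C. adm C C \<Longrightarrow> adm C (f C) \<and> prob (f C) \<ge> (prob C + s C) / 2" by metis
  define C where "C n = (f ^^ n) {}" for n
  have C0: "C 0 = {}" and CS: "C (Suc n) = f (C n)" for n by (auto simp: C_def)
  have adm: "adm (C n) (C n)" for n
  proof (induction n)
    case 0
    then show ?case using assms by (simp add: adm_def C0)
  next
    case (Suc n)
    then show ?case using f[OF Suc] by (simp add: adm_def CS)
  qed
  have inc: "incseq C" using f[OF adm] by (intro incseq_SucI) (auto simp: adm_def CS)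
  have ev: "C n \<in> events" for n using adm[of n] by (simp add: adm_def)
  define B where "B = (\<Union>n. C n)"
  have B: "B \<in> events" "B \<subseteq> A" using adm by (auto simp: B_def adm_def)
  have lim: "(\<lambda>n. prob (C n)) \<longlonglongrightarrow> prob B"
    unfolding B_def using ev inc by (intro finite_Lim_measure_incseq) auto
  have le: "prob B \<le> t" using lim adm by (intro LIMSEQ_le_const2[OF lim]) (auto simp: adm_def)
  have "prob B = t"
  proof (rule ccontr)
    assume "prob B \<noteq> t"
    with le have lt: "prob B < t" by simp
    have "prob (A - B) = prob A - prob B" using B assms by (simp add: finite_measure_Diff)
    then have "0 < prob (A - B)" using lt assms by simp
    then obtain D where D: "D \<in> events" "D \<subseteq> A - B" "0 < prob D" "prob D < t - prob B"
      using atomless_small_subset[OF assms(1), of "A - B" "t - prob B"] B assms lt by auto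
    have p: "prob (B \<union> D) = prob B + prob D"
      using B D by (intro finite_measure_Union) auto
    \<comment> \<open>All of \<open>B \<union> D\<close> is within the budget at each stage. The
      greedy choice then goes at least half way to \<open>prob B + prob D\<close>, and in the limit
      \<open>prob B\<close> would be at least \<open>prob B + prob D / 2\<close>.\<close>
    have "prob B + prob D \<le> s (C n)" for n
    proof -
      have "adm (C n) (B \<union> D)" using B D p by (auto simp: adm_def B_def)
      then show ?thesis unfolding s_def using bdd p by (metis cSUP_upper mem_Collect_eq)
    qed
    then have ge: "prob (C (Suc n)) \<ge> (prob (C n) + (prob B + prob D)) / 2" for n
      using f[OF adm[of n]] by (force simp: CS intro: order_trans[rotated])
    have "(\<lambda>n. (prob (C n) + (prob B + prob D)) / 2) \<longlonglongrightarrow> (prob B + (prob B + prob D)) / 2"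
      by (intro tendsto_intros lim) auto
    then have "(prob B + (prob B + prob D)) / 2 \<le> prob B"
      using ge by (intro LIMSEQ_le[OF _ LIMSEQ_Suc[OF lim]]) auto
    with D show False by simp
  qed
  with B that show thesis by blast
qed

text \<open>The uniform law on (0, 1), given by its distribution function. The case
  \<open>t = 0\<close> forces \<open>U > 0\<close> almost surely, which settles negative
  \<open>t\<close>.\<close>

definition uniform_rv :: "('a \<Rightarrow> real) \<Rightarrow> bool" where
  "uniform_rv U \<longleftrightarrow> U \<in> borel_measurable M \<and> (\<forall>t\<ge>0. prob {\<omega>\<in>space M. U \<omega> \<le> t} = min t 1)"

lemma atomless_between:
  assumes "atomless M" "A \<in> events" "B \<in> events" "A \<subseteq> B" "prob A \<le> t" "t \<le> prob B"
  obtains C where "C \<in> events" "A \<subseteq> C" "C \<subseteq> B" "prob C = t"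
proof -
  have "prob (B - A) = prob B - prob A" using assms by (simp add: finite_measure_Diff)
  then obtain D where D: "D \<in> events" "D \<subseteq> B - A" "prob D = t - prob A"
    using atomless_exact_subset[OF assms(1), of "B - A" "t - prob A"] assms by auto
  have "prob (A \<union> D) = prob A + prob D" using D assms by (intro finite_measure_Union) auto
  then show thesis using D assms by (intro that[of "A \<union> D"]) auto
qed

text \<open>The sets play the role of the sublevel sets of a uniform variable at the dyadic numbers
  \<open>k / 2 ^ n\<close>. Each level keeps the sets of the previous one at the even indices and
  inserts sets of intermediate probability at the odd ones.\<close>

lemma atomless_dyadic_chain:
  assumes "atomless M"
  obtains A :: "nat \<Rightarrow> nat \<Rightarrow> 'a set" where
    "\<And>n k. k \<le> 2 ^ n \<Longrightarrow> A n k \<in> events"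
    "\<And>n k. k \<le> 2 ^ n \<Longrightarrow> prob (A n k) = k / 2 ^ n"
    "\<And>n k. k < 2 ^ n \<Longrightarrow> A n k \<subseteq> A n (Suc k)"
    "\<And>n k. A (Suc n) (2 * k) = A n k"
proof -
  define mid where "mid P Q = (SOME C. C \<in> events \<and> P \<subseteq> C \<and> C \<subseteq> Q \<and> prob C = (prob P + prob Q) / 2)"
    for P Q
  have mid: "mid P Q \<in> events \<and> P \<subseteq> mid P Q \<and> mid P Q \<subseteq> Q \<and> prob (mid P Q) = (prob P + prob Q) / 2"
    if PQ: "P \<in> events" "Q \<in> events" "P \<subseteq> Q" for P Q
  proof -
    have "prob P \<le> prob Q" using PQ by (simp add: finite_measure_mono)
    then have mean: "prob P \<le> (prob P + prob Q) / 2" "(prob P + prob Q) / 2 \<le> prob Q" by auto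
    have "\<exists>C. C \<in> events \<and> P \<subseteq> C \<and> C \<subseteq> Q \<and> prob C = (prob P + prob Q) / 2"
      by (rule atomless_between[OF assms PQ mean]) blast
    then show ?thesis unfolding mid_def by (rule someI_ex)
  qed
  \<comment> \<open>The recursion runs over the level and returns a function of the index. Level 0
    consists of the empty set at index 0 and the whole space at index 1.\<close>
  define A where "A = rec_nat (\<lambda>k::nat. if k = 0 then {} else space M)
    (\<lambda>n F k. if even k then F (k div 2) else mid (F (k div 2)) (F (Suc (k div 2))))"
  have A0: "A 0 k = (if k = 0 then {} else space M)" for k by (simp add: A_def)
  have AS: "A (Suc n) k = (if even k then A n (k div 2) else mid (A n (k div 2)) (A n (Suc (k div 2))))"
    for n k by (simp add: A_def)
  have main: "(\<forall>k\<le>2 ^ n. A n k \<in> events \<and> prob (A n k) = k / 2 ^ n) \<and> (\<forall>k<2 ^ n. A n k \<subseteq> A n (Suc k))" for n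
  proof (induction n)
    case 0
    then show ?case by (auto simp: A0 prob_space le_Suc_eq)
  next
    case (Suc n)
    have m: "mid (A n j) (A n (Suc j)) \<in> events \<and> A n j \<subseteq> mid (A n j) (A n (Suc j)) \<and>
       mid (A n j) (A n (Suc j)) \<subseteq> A n (Suc j) \<and> prob (mid (A n j) (A n (Suc j))) = (2 * j + 1) / 2 ^ Suc n"
      if "j < 2 ^ n" for j
      using mid[of "A n j" "A n (Suc j)"] Suc that by (auto simp: Suc_le_eq field_simps)
    show ?case
    proof (intro conjI allI impI)
      fix k :: nat assume k: "k \<le> 2 ^ Suc n"
      show "A (Suc n) k \<in> events" "prob (A (Suc n) k) = k / 2 ^ Suc n"
      proof -
        show "A (Suc n) k \<in> events"
        proof (cases "even k")
          case True
          then show ?thesis using Suc k by (auto simp: AS)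
        next
          case False
          then obtain j where "k = 2 * j + 1" by (elim oddE)
          then show ?thesis using m[of j] k by (auto simp: AS)
        qed
        show "prob (A (Suc n) k) = k / 2 ^ Suc n"
        proof (cases "even k")
          case True
          then obtain j where "k = 2 * j" by (elim evenE)
          then show ?thesis using Suc k by (auto simp: AS)
        next
          case False
          then obtain j where "k = 2 * j + 1" by (elim oddE)
          then show ?thesis using m[of j] k by (auto simp: AS)
        qed
      qed
    next
      fix k :: nat assume k: "k < 2 ^ Suc n"
      show "A (Suc n) k \<subseteq> A (Suc n) (Suc k)"
      proof (cases "even k")
        case True
        then obtain j where "k = 2 * j" by (elim evenE)
        then show ?thesis using m[of j] k by (auto simp: AS)
      next
        case False
        then obtain j where "k = 2 * j + 1" by (elim oddE)
        then show ?thesis using m[of j] k by (auto simp: AS)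
      qed
    qed
  qed
  show thesis using main by (intro that[of A]) (auto simp: AS)
qed

text \<open>\<open>U \<omega>\<close> is the infimum of the dyadic numbers \<open>k / 2 ^ n\<close>
  with \<omega> in \<open>A n k\<close>. Its distribution function is then squeezed between the
  known probabilities of these sets.\<close>

lemma atomless_uniform_rv:
  assumes "atomless M"
  obtains U where "uniform_rv U"
proof -
  obtain A :: "nat \<Rightarrow> nat \<Rightarrow> 'a set" where
    ev: "\<And>n k. k \<le> 2 ^ n \<Longrightarrow> A n k \<in> events" and
    pr: "\<And>n k. k \<le> 2 ^ n \<Longrightarrow> prob (A n k) = k / 2 ^ n" and
    suc: "\<And>n k. k < 2 ^ n \<Longrightarrow> A n k \<subseteq> A n (Suc k)" and
    ref: "\<And>n k. A (Suc n) (2 * k) = A n k"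
    using atomless_dyadic_chain[OF assms] by metis
  have mono: "k \<le> l \<Longrightarrow> l \<le> 2 ^ n \<Longrightarrow> A n k \<subseteq> A n l" for n k l
  proof (induction l rule: dec_induct)
    case (step l)
    then have "A n k \<subseteq> A n l" by simp
    also have "\<dots> \<subseteq> A n (Suc l)" using suc step by simp
    finally show ?case .
  qed simp
  have ref': "A (n + d) (k * 2 ^ d) = A n k" for n d k
  proof (induction d)
    case (Suc d)
    then show ?case using ref[of "n + d" "k * 2 ^ d"] by (simp add: ac_simps)
  qed simp
  \<comment> \<open>Sets of different levels are compared at the common level \<open>n + m\<close>,
    where their indices become \<open>k * 2 ^ m\<close> and \<open>l * 2 ^ n\<close>.\<close>
  have chain: "A n k \<subseteq> A m l" if "k \<le> 2 ^ n" "l \<le> 2 ^ m" "k / 2 ^ n \<le> (l / 2 ^ m :: real)" for n k m l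
  proof -
    have "real (k * 2 ^ m) \<le> real (l * 2 ^ n)" using that(3) by (simp add: field_simps)
    then have "k * 2 ^ m \<le> l * 2 ^ n" by linarith
    moreover have "l * 2 ^ n \<le> 2 ^ (n + m)" using that by (simp add: power_add mult.commute)
    ultimately have "A (n + m) (k * 2 ^ m) \<subseteq> A (n + m) (l * 2 ^ n)" by (rule mono)
    then show ?thesis using ref'[of n m k] ref'[of m n l] by (simp add: add.commute)
  qed
  \<comment> \<open>The disjunct \<open>k = 2 ^ n\<close> keeps the set nonempty: \<open>A n (2 ^ n)\<close> is only known to have probability 1.\<close>
  define S where "S \<omega> = {k / 2 ^ n :: real | n k. k \<le> (2::nat) ^ n \<and> (\<omega> \<in> A n k \<or> k = 2 ^ n)}" for \<omega>
  define U where "U \<omega> = Inf (S \<omega>)" for \<omega>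
  have one: "1 \<in> S \<omega>" for \<omega> unfolding S_def by (auto intro!: exI[where x = "0::nat"])
  then have ne: "S \<omega> \<noteq> {}" for \<omega> by auto
  have bd: "bdd_below (S \<omega>)" for \<omega> by (rule bdd_belowI[of _ 0]) (auto simp: S_def)
  have U1: "U \<omega> \<le> 1" and U0: "0 \<le> U \<omega>" for \<omega>
  proof -
    show "U \<omega> \<le> 1" unfolding U_def using bd one by (simp add: cInf_lower)
    show "0 \<le> U \<omega>" unfolding U_def by (rule cInf_greatest[OF ne]) (auto simp: S_def)
  qed
  define J where "J t = {(n, k). k \<le> (2::nat) ^ n \<and> real k / 2 ^ n < t}" for t
  \<comment> \<open>For \<open>t \<le> 1\<close> a dyadic number below \<open>t\<close> is not 1, so
    a witness from \<open>S \<omega>\<close> has \<open>k \<noteq> 2 ^ n\<close> and \<omega> really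
    lies in \<open>A n k\<close>.\<close>
  have less: "{\<omega>\<in>space M. U \<omega> < t} = (\<Union>(n, k)\<in>J t. A n k)" if "t \<le> 1" for t
  proof (intro set_eqI iffI)
    fix \<omega> assume "\<omega> \<in> {\<omega>\<in>space M. U \<omega> < t}"
    then have "U \<omega> < t" by simp
    then obtain x where "x \<in> S \<omega>" "x < t" unfolding U_def using cInf_less_iff[OF ne bd] by blast
    then obtain n k where "x = k / 2 ^ n" "k \<le> 2 ^ n" "\<omega> \<in> A n k \<or> k = 2 ^ n" "x < t"
      unfolding S_def by blast
    with that show "\<omega> \<in> (\<Union>(n, k)\<in>J t. A n k)"
      by (auto simp: J_def)
  next
    fix \<omega> assume "\<omega> \<in> (\<Union>(n, k)\<in>J t. A n k)"
    then obtain n and k :: nat where nk: "k \<le> 2 ^ n" "k / 2 ^ n < t" "\<omega> \<in> A n k" by (auto simp: J_def)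
    then have "k / 2 ^ n \<in> S \<omega>" unfolding S_def by blast
    then have "U \<omega> \<le> k / 2 ^ n" unfolding U_def using bd by (rule cInf_lower)
    then show "\<omega> \<in> {\<omega>\<in>space M. U \<omega> < t}" using nk ev sets.sets_into_space by fastforce
  qed
  have cnt: "countable (J t)" for t by simp
  have lev: "{\<omega>\<in>space M. U \<omega> < t} \<in> events" for t
  proof (cases "t \<le> 1")
    case True
    show ?thesis unfolding less[OF True] using cnt ev by (intro sets.countable_UN') (auto simp: J_def)
  next
    case False
    then have "{\<omega>\<in>space M. U \<omega> < t} = space M" using U1 by (auto simp: not_le intro: le_less_trans)
    then show ?thesis by simp
  qed
  then have meas[measurable]: "U \<in> borel_measurable M" by (simp add: borel_measurable_iff_less)
  have dens: "\<exists>n k. k \<le> (2::nat) ^ n \<and> s < real k / 2 ^ n \<and> real k / 2 ^ n < t" if "0 \<le> s" "s < t" "t \<le> 1" for s t :: real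
  proof -
    obtain n where "1 / (t - s) < 2 ^ n" using real_arch_pow[of 2 "1 / (t - s)"] by auto
    then have n: "1 < t * 2 ^ n - s * 2 ^ n" using that by (simp add: field_simps)
    \<comment> \<open>The first multiple of \<open>1 / 2 ^ n\<close> strictly above
      \<open>s\<close>; it is still below \<open>t\<close> because the gap \<open>t - s\<close>
      exceeds \<open>1 / 2 ^ n\<close>.\<close>
    define k where "k = nat \<lfloor>s * 2 ^ n\<rfloor> + 1"
    have k: "real k = of_int \<lfloor>s * 2 ^ n\<rfloor> + 1" using that by (simp add: k_def)
    then have kk: "s * 2 ^ n < k" "k < t * 2 ^ n" using n by linarith+
    have "t * 2 ^ n \<le> 2 ^ n" using that by (simp add: mult_left_le_one_le)
    with kk have "real k < 2 ^ n" by linarith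
    then have "k \<le> 2 ^ n" by simp
    then show ?thesis using kk by (intro exI[of _ n] exI[of _ k]) (auto simp: field_simps)
  qed
  \<comment> \<open>By \<open>chain\<close>, every set contributing to
    \<open>U \<omega> < k / 2 ^ n\<close> lies in \<open>A n k\<close>, while \<open>A n k\<close>
    itself lies in \<open>U \<omega> \<le> k / 2 ^ n\<close>. Density of the dyadic numbers turns
    these two bounds into the exact distribution function.\<close>
  have upper: "prob {\<omega>\<in>space M. U \<omega> < k / 2 ^ n} \<le> k / 2 ^ n" if "k \<le> 2 ^ n" for n k :: nat
  proof -
    have "k / 2 ^ n \<le> (1::real)" using that by (simp flip: of_nat_le_iff)
    then have "{\<omega>\<in>space M. U \<omega> < k / 2 ^ n} \<subseteq> A n k"
      unfolding less[OF \<open>k / 2 ^ n \<le> 1\<close>] using chain[OF _ that] by (auto simp: J_def dest: less_imp_le)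
    then show ?thesis using finite_measure_mono[OF _ ev[OF that]] pr[OF that] by simp
  qed
  have lower: "k / 2 ^ n \<le> prob {\<omega>\<in>space M. U \<omega> \<le> k / 2 ^ n}" if "k \<le> 2 ^ n" for n k :: nat
  proof -
    have "A n k \<subseteq> {\<omega>\<in>space M. U \<omega> \<le> k / 2 ^ n}"
    proof
      fix \<omega> assume w: "\<omega> \<in> A n k"
      then have "k / 2 ^ n \<in> S \<omega>" unfolding S_def using that by blast
      then have "U \<omega> \<le> k / 2 ^ n" unfolding U_def using bd by (rule cInf_lower)
      then show "\<omega> \<in> {\<omega>\<in>space M. U \<omega> \<le> k / 2 ^ n}" using w ev[OF that] sets.sets_into_space by fastforce
    qed
    then have "prob (A n k) \<le> prob {\<omega>\<in>space M. U \<omega> \<le> k / 2 ^ n}" by (intro finite_measure_mono) auto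
    then show ?thesis using pr[OF that] by simp
  qed
  have "prob {\<omega>\<in>space M. U \<omega> \<le> t} = min t 1" if t: "0 \<le> t" for t
  proof (cases "t < 1")
    case True
    have "prob {\<omega>\<in>space M. U \<omega> \<le> t} \<le> t"
    proof (rule dense_ge_bounded[OF True])
      fix x assume x: "t < x" "x < 1"
      then obtain n and k :: nat where nk: "k \<le> 2 ^ n" "t < k / 2 ^ n" "k / 2 ^ n < x" using dens[of t x] t by auto
      have "prob {\<omega>\<in>space M. U \<omega> \<le> t} \<le> prob {\<omega>\<in>space M. U \<omega> < k / 2 ^ n}"
        using nk by (intro finite_measure_mono) auto
      then show "prob {\<omega>\<in>space M. U \<omega> \<le> t} \<le> x" using upper[OF nk(1)] nk by simp
    qed
    moreover have "t \<le> prob {\<omega>\<in>space M. U \<omega> \<le> t}"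
    proof (rule dense_le)
      fix x assume x: "x < t"
      show "x \<le> prob {\<omega>\<in>space M. U \<omega> \<le> t}"
      proof (cases "x < 0")
        case True
        then show ?thesis by (meson measure_nonneg less_imp_le order_trans)
      next
        case False
        then obtain n and k :: nat where nk: "k \<le> 2 ^ n" "x < k / 2 ^ n" "k / 2 ^ n < t"
          using dens[of x t] x \<open>t < 1\<close> by auto
        have "prob {\<omega>\<in>space M. U \<omega> \<le> k / 2 ^ n} \<le> prob {\<omega>\<in>space M. U \<omega> \<le> t}"
          using nk by (intro finite_measure_mono) auto
        then show ?thesis using lower[OF nk(1)] nk by simp
      qed
    qed
    ultimately show ?thesis using True by simp
  next
    case False
    then have "{\<omega>\<in>space M. U \<omega> \<le> t} = space M" using U1 by (auto simp: not_less intro: order_trans)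
    then show ?thesis using False by (simp add: prob_space)
  qed
  then show thesis using meas by (intro that[of U]) (simp add: uniform_rv_def)
qed

subsection \<open>Cyclic shifts and quantiles\<close>

text \<open>The shift exchanges the pieces (a, 1 - h] and (1 - h, 1] by translations, hence
  preserves Lebesgue measure. The cases ask whether \<open>t\<close> lies in the fixed part, in the
  image (a, a + h] of the last piece, or above it.\<close>

lemma uniform_rv_cyclic_shift:
  assumes "uniform_rv U" "0 \<le> a" "0 < h" "a + h \<le> 1"
  shows "uniform_rv (\<lambda>\<omega>. cyclic_shift a h (U \<omega>))"
proof -
  have [measurable]: "U \<in> borel_measurable M" using assms by (simp add: uniform_rv_def)
  have U: "prob {\<omega>\<in>space M. U \<omega> \<le> t} = min t 1" if "0 \<le> t" for t
    using assms that by (simp add: uniform_rv_def)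
  have I: "prob {\<omega>\<in>space M. s < U \<omega> \<and> U \<omega> \<le> t} = min t 1 - min s 1" if "0 \<le> s" "s \<le> t" for s t
  proof -
    have "{\<omega>\<in>space M. s < U \<omega> \<and> U \<omega> \<le> t} = {\<omega>\<in>space M. U \<omega> \<le> t} - {\<omega>\<in>space M. U \<omega> \<le> s}" by auto
    moreover have "prob ({\<omega>\<in>space M. U \<omega> \<le> t} - {\<omega>\<in>space M. U \<omega> \<le> s}) =
        prob {\<omega>\<in>space M. U \<omega> \<le> t} - prob {\<omega>\<in>space M. U \<omega> \<le> s}"
      using that by (intro finite_measure_Diff) auto
    ultimately show ?thesis using that U by simp
  qed
  have "prob {\<omega>\<in>space M. cyclic_shift a h (U \<omega>) \<le> t} = min t 1" if t: "0 \<le> t" for t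
  proof -
    consider "t \<le> a" | "a < t" "t \<le> a + h" | "a + h < t" by linarith
    then show ?thesis
    proof cases
      case 1
      then have "{\<omega>\<in>space M. cyclic_shift a h (U \<omega>) \<le> t} = {\<omega>\<in>space M. U \<omega> \<le> t}"
        using assms by (auto simp: cyclic_shift_def)
      then show ?thesis using U t by simp
    next
      case 2
      then have "{\<omega>\<in>space M. cyclic_shift a h (U \<omega>) \<le> t} =
          {\<omega>\<in>space M. U \<omega> \<le> a} \<union> {\<omega>\<in>space M. 1 - h < U \<omega> \<and> U \<omega> \<le> t + (1 - a - h)}"
        using assms by (auto simp: cyclic_shift_def)
      then have "prob {\<omega>\<in>space M. cyclic_shift a h (U \<omega>) \<le> t} =
          prob {\<omega>\<in>space M. U \<omega> \<le> a} + prob {\<omega>\<in>space M. 1 - h < U \<omega> \<and> U \<omega> \<le> t + (1 - a - h)}"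
        using assms by (simp, intro finite_measure_Union) auto
      then show ?thesis using U I 2 assms by simp
    next
      case 3
      \<comment> \<open>The last piece lands entirely below \<open>t\<close>; the other points need
        \<open>U \<omega> \<le> t - h\<close>, capped at \<open>1 - h\<close>, where wrapping
        starts.\<close>
      then have "{\<omega>\<in>space M. cyclic_shift a h (U \<omega>) \<le> t} =
          {\<omega>\<in>space M. U \<omega> \<le> min (t - h) (1 - h)} \<union> {\<omega>\<in>space M. 1 - h < U \<omega> \<and> U \<omega> \<le> t + (1 - a - h)}"
        using assms by (auto simp: cyclic_shift_def)
      then have "prob {\<omega>\<in>space M. cyclic_shift a h (U \<omega>) \<le> t} =
          prob {\<omega>\<in>space M. U \<omega> \<le> min (t - h) (1 - h)} + prob {\<omega>\<in>space M. 1 - h < U \<omega> \<and> U \<omega> \<le> t + (1 - a - h)}"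
        using assms by (simp, intro finite_measure_Union) auto
      then show ?thesis using U I 3 assms by (simp add: min_def split: if_splits)
    qed
  qed
  then show ?thesis by (simp add: uniform_rv_def)
qed

lemma uniform_rv_funpow_cyclic_shift:
  assumes "uniform_rv U" "0 \<le> a" "0 < h" "a + h \<le> 1"
  shows "uniform_rv (\<lambda>\<omega>. (cyclic_shift a h ^^ i) (U \<omega>))"
proof (induction i)
  case (Suc i)
  then show ?case using uniform_rv_cyclic_shift[OF Suc assms(2-)] by simp
qed (use assms in simp)

lemma uniform_rv_AE:
  assumes "uniform_rv U"
  shows "AE \<omega> in M. 0 < U \<omega> \<and> U \<omega> < 1"
proof -
  have [measurable]: "U \<in> borel_measurable M" using assms by (simp add: uniform_rv_def)
  have U: "prob {\<omega>\<in>space M. U \<omega> \<le> t} = min t 1" if "0 \<le> t" for t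
    using assms that by (simp add: uniform_rv_def)
  have "prob {\<omega>\<in>space M. U \<omega> < 1} = 1"
  proof (rule antisym)
    show "1 \<le> prob {\<omega>\<in>space M. U \<omega> < 1}"
    proof (rule dense_le_bounded[of 0])
      fix t :: real assume t: "0 < t" "t < 1"
      have "prob {\<omega>\<in>space M. U \<omega> \<le> t} \<le> prob {\<omega>\<in>space M. U \<omega> < 1}"
        using t by (intro finite_measure_mono) auto
      then show "t \<le> prob {\<omega>\<in>space M. U \<omega> < 1}" using U t by simp
    qed simp
  qed simp
  then have "AE \<omega> in M. U \<omega> < 1" by (simp add: prob_Collect_eq_1)
  moreover have "prob {\<omega>\<in>space M. U \<omega> \<le> 0} = 0" using U[of 0] by simp
  then have "AE \<omega> in M. \<not> U \<omega> \<le> 0" by (simp add: prob_Collect_eq_0)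
  ultimately show ?thesis by eventually_elim auto
qed

text \<open>Set to 0 outside \<open>(0, 1)\<close>, where the infimum may be taken over an empty or unbounded set.\<close>
definition quantile :: "('a \<Rightarrow> real) \<Rightarrow> real \<Rightarrow> real" where
  "quantile X u = (if 0 < u \<and> u < 1 then Inf {x. u \<le> prob {\<omega>\<in>space M. X \<omega> \<le> x}} else 0)"

context
  fixes X :: "'a \<Rightarrow> real"
  assumes X [measurable]: "X \<in> borel_measurable M"
begin

text \<open>\<open>D.I\<close> is the generalized inverse of the distribution function known from
  Skorohod's theorem. It brings the equivalence behind \<open>quantile_le_iff\<close> and the fact
  that it carries Lebesgue measure on (0, 1) to the law of \<open>X\<close>.\<close>

interpretation D: cdf_distribution "distr M borel X"
  unfolding cdf_distribution_def by simp

lemma cdf_distr_eq: "cdf (distr M borel X) x = prob {\<omega>\<in>space M. X \<omega> \<le> x}"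
  by (simp add: cdf_def measure_distr vimage_def Int_def conj_commute)

lemma quantile_eq: "0 < u \<Longrightarrow> u < 1 \<Longrightarrow> quantile X u = D.I u"
  by (simp add: quantile_def cdf_distr_eq)

lemma quantile_le_iff:
  "0 < u \<Longrightarrow> u < 1 \<Longrightarrow> quantile X u \<le> x \<longleftrightarrow> u \<le> prob {\<omega>\<in>space M. X \<omega> \<le> x}"
  using D.pseudoinverse[of u x] by (simp add: quantile_eq cdf_distr_eq)

lemma quantile_mono: "0 < u \<Longrightarrow> u \<le> v \<Longrightarrow> v < 1 \<Longrightarrow> quantile X u \<le> quantile X v"
  using quantile_le_iff[of u "quantile X v"] quantile_le_iff[of v "quantile X v"] by auto

lemma measurable_quantile [measurable]: "quantile X \<in> borel_measurable borel"
proof -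
  have "(\<lambda>u. indicator {0<..<1} u *\<^sub>R D.I u) \<in> borel_measurable borel"
    using D.measurable_CI by (subst (asm) borel_measurable_restrict_space_iff) auto
  also have "(\<lambda>u. indicator {0<..<1} u *\<^sub>R D.I u) = quantile X"
    by (auto simp: fun_eq_iff indicator_def cdf_distr_eq quantile_def)
  finally show ?thesis .
qed

lemma VaR_eq_quantile: "0 < u \<Longrightarrow> u < 1 \<Longrightarrow> VaR M u X = ereal (quantile X u)"
  unfolding VaR_def by (rule Inf_eqI) (use quantile_le_iff in auto)

text \<open>Inverse transform sampling: up to a null set,
  \<open>quantile X (U \<omega>) \<le> x\<close> is the event that \<open>U \<omega>\<close> is at
  most F(x), which has probability F(x), for F the distribution function of
  \<open>X\<close>.\<close>

lemma distr_quantile_uniform_rv: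
  assumes "uniform_rv U"
  shows "distr M borel (\<lambda>\<omega>. quantile X (U \<omega>)) = distr M borel X"
proof -
  have [measurable]: "U \<in> borel_measurable M" using assms by (simp add: uniform_rv_def)
  have "cdf (distr M borel (\<lambda>\<omega>. quantile X (U \<omega>))) x = cdf (distr M borel X) x" for x
  proof -
    have "cdf (distr M borel (\<lambda>\<omega>. quantile X (U \<omega>))) x = prob {\<omega>\<in>space M. quantile X (U \<omega>) \<le> x}"
      by (simp add: cdf_def measure_distr vimage_def Int_def conj_commute)
    also have "\<dots> = prob {\<omega>\<in>space M. U \<omega> \<le> prob {\<omega>\<in>space M. X \<omega> \<le> x}}"
      using uniform_rv_AE[OF assms]
      by (intro finite_measure_eq_AE) (auto elim!: AE_mp simp: quantile_le_iff)
    also have "\<dots> = cdf (distr M borel X) x"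
      using assms by (simp add: uniform_rv_def cdf_distr_eq)
    finally show ?thesis .
  qed
  then show ?thesis by (intro cdf_unique) auto
qed

text \<open>Change of variables: the quantile function on (0, 1) has the law of \<open>X\<close>, so
  both sides are integrals of \<open>f\<close> against that law.\<close>

lemma integral_quantile:
  fixes f :: "real \<Rightarrow> real"
  assumes [measurable]: "f \<in> borel_measurable borel"
  shows "integrable M (\<lambda>\<omega>. f (X \<omega>)) \<longleftrightarrow> set_integrable lborel {0<..<1} (\<lambda>u. f (quantile X u))"
    and "(\<integral>\<omega>. f (X \<omega>) \<partial>M) = (LBINT u:{0<..<1}. f (quantile X u))"
proof -
  let ?\<Omega> = "restrict_space lborel {0<..<1::real}"
  have I: "D.I \<in> borel_measurable ?\<Omega>" using D.measurable_CI
    by (simp cong: measurable_cong_sets add: sets_restrict_space)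
  have "integrable M (\<lambda>\<omega>. f (X \<omega>)) \<longleftrightarrow> integrable (distr M borel X) f"
    by (simp add: integrable_distr_eq)
  also have "\<dots> \<longleftrightarrow> integrable ?\<Omega> (\<lambda>u. f (D.I u))"
    by (subst D.distr_I_eq_M[symmetric], subst integrable_distr_eq[OF I]) auto
  also have "\<dots> \<longleftrightarrow> set_integrable lborel {0<..<1} (\<lambda>u. f (D.I u))"
    by (subst integrable_restrict_space) (auto simp: set_integrable_def)
  also have "\<dots> \<longleftrightarrow> set_integrable lborel {0<..<1} (\<lambda>u. f (quantile X u))"
    by (intro set_integrable_cong) (auto simp: quantile_eq)
  finally show "integrable M (\<lambda>\<omega>. f (X \<omega>)) \<longleftrightarrow> set_integrable lborel {0<..<1} (\<lambda>u. f (quantile X u))" .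
  have "(\<integral>\<omega>. f (X \<omega>) \<partial>M) = (\<integral>x. f x \<partial>distr M borel X)"
    by (simp add: integral_distr)
  also have "\<dots> = (\<integral>u. f (D.I u) \<partial>?\<Omega>)"
    by (subst D.distr_I_eq_M[symmetric], subst integral_distr[OF I]) auto
  also have "\<dots> = (LBINT u:{0<..<1}. f (D.I u))"
    by (subst integral_restrict_space) (auto simp: set_lebesgue_integral_def)
  also have "\<dots> = (LBINT u:{0<..<1}. f (quantile X u))"
    by (intro set_lebesgue_integral_cong) (auto simp: quantile_eq)
  finally show "(\<integral>\<omega>. f (X \<omega>) \<partial>M) = (LBINT u:{0<..<1}. f (quantile X u))" .
qed

end

subsection \<open>Expected shortfall\<close>

lemma set_integrable_quantile:
  assumes "integrable M X" "A \<subseteq> {0<..<1}" "A \<in> sets borel"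
  shows "set_integrable lborel A (quantile X)"
proof -
  have "set_integrable lborel {0<..<1} (quantile X)"
    using integral_quantile(1)[OF borel_measurable_integrable[OF assms(1)], of "\<lambda>x. x"] assms(1) by simp
  then show ?thesis by (rule set_integrable_subset) (use assms in auto)
qed

lemma set_integrable_const_Ioo: "set_integrable lborel {a<..<b::real} (\<lambda>_. c::real)"
  unfolding set_integrable_def by (cases "a \<le> b") auto

lemma set_integral_const_Ioo: "a \<le> b \<Longrightarrow> (LBINT u:{a<..<b::real}. (c::real)) = (b - a) * c"
  unfolding set_lebesgue_integral_def by simp

lemma ES_eq_quantile:
  assumes "integrable M X" "0 \<le> a" "a < 1"
  shows "ES M a X = ereal ((LBINT u:{a<..<1}. quantile X u) / (1 - a))"
proof -
  have "(LBINT u:{a<..<1}. real_of_ereal (VaR M u X)) = (LBINT u:{a<..<1}. quantile X u)"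
    using assms by (intro set_lebesgue_integral_cong) (auto simp: VaR_eq_quantile)
  then show ?thesis using assms by (simp add: ES_def)
qed

section \<open>Domination of the quantiles by the expected shortfall, and quasi-convexity\<close>

lemma VaR_le_VaR_plus: "VaR M a X \<le> VaR_plus M a X"
  unfolding VaR_def VaR_plus_def by (intro Inf_superset_mono) auto

text \<open>Used in two ways: to bound the upper quantile at a level by all quantiles at higher
  levels, and to let a map dominating \<open>VaR M a\<close> dominate the upper quantiles at levels
  below \<open>a\<close>.\<close>

lemma VaR_plus_le_VaR: "b < a \<Longrightarrow> VaR_plus M b X \<le> VaR M a X"
  unfolding VaR_def VaR_plus_def by (intro Inf_superset_mono) auto

text \<open>The expected shortfall averages quantiles at levels in (a, 1), each at least the upper
  quantile at \<open>a\<close>. The case distinction is there because for \<open>a = 0\<close> the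
  latter may be minus infinity.\<close>

lemma VaR_plus_le_ES:
  assumes X: "integrable M X" and a: "0 \<le> a" "a < 1"
  shows "VaR_plus M a X \<le> ES M a X"
proof -
  have q: "VaR_plus M a X \<le> ereal (quantile X u)" if "u \<in> {a<..<1}" for u
    using VaR_plus_le_VaR[of a u X] VaR_eq_quantile[of X u] X that a by auto
  show ?thesis
  proof (cases "VaR_plus M a X")
    case (real r)
    then have "(LBINT u:{a<..<1}. r) \<le> (LBINT u:{a<..<1}. quantile X u)"
      using q X a by (intro set_integral_mono set_integrable_quantile set_integrable_const_Ioo) auto
    then have "r \<le> (LBINT u:{a<..<1}. quantile X u) / (1 - a)"
      using a by (simp add: set_integral_const_Ioo field_simps)
    then show ?thesis using real X a by (simp add: ES_eq_quantile)
  next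
    case PInf
    then show ?thesis using q[of "(a + 1) / 2"] a by auto
  qed simp
qed

text \<open>The inequality of the Rockafellar-Uryasev formula, valid at every \<open>x\<close>: the
  integrand \<open>quantile X u - x\<close> is replaced by its positive part, and the range is then
  enlarged to (0, 1).\<close>

lemma tail_integral_le:
  assumes X: "integrable M X" and a: "0 \<le> a" "a < 1"
  shows "(LBINT u:{a<..<1}. quantile X u) \<le> (1 - a) * x + (\<integral>\<omega>. max 0 (X \<omega> - x) \<partial>M)"
proof -
  let ?f = "\<lambda>u. max 0 (quantile X u - x)"
  have "integrable M (\<lambda>\<omega>. max 0 (X \<omega> - x))" using X by auto
  then have int: "set_integrable lborel {0<..<1} ?f"
    using integral_quantile(1)[OF borel_measurable_integrable[OF X], of "\<lambda>y. max 0 (y - x)"] by simp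
  then have int': "set_integrable lborel {a<..<1} ?f"
    by (rule set_integrable_subset) (use a in auto)
  have q: "set_integrable lborel {a<..<1} (quantile X)" using X a by (intro set_integrable_quantile) auto
  have "(LBINT u:{a<..<1}. quantile X u) - (LBINT u:{a<..<1}. x) = (LBINT u:{a<..<1}. quantile X u - x)"
    using q by (intro set_integral_diff(2)[symmetric] set_integrable_const_Ioo)
  also have "\<dots> \<le> (LBINT u:{a<..<1}. ?f u)"
    using q int' by (intro set_integral_mono set_integral_diff(1) set_integrable_const_Ioo) auto
  also have "\<dots> \<le> (LBINT u:{0<..<1}. ?f u)"
    using int int' a unfolding set_lebesgue_integral_def set_integrable_def
    by (intro integral_mono) (auto simp: indicator_def)
  also have "\<dots> = (\<integral>\<omega>. max 0 (X \<omega> - x) \<partial>M)"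
    using integral_quantile(2)[OF borel_measurable_integrable[OF X], of "\<lambda>y. max 0 (y - x)"] by simp
  finally show ?thesis using a by (simp add: set_integral_const_Ioo)
qed

text \<open>The minimum is attained at the quantile: by monotonicity \<open>quantile X u - x\<close>
  is nonpositive for \<open>u \<le> a\<close> and nonnegative beyond, so its positive part lives on
  (a, 1) and equals it there.\<close>

lemma tail_integral_eq:
  assumes X: "integrable M X" and a: "0 < a" "a < 1"
  defines "x \<equiv> quantile X a"
  shows "(LBINT u:{a<..<1}. quantile X u) = (1 - a) * x + (\<integral>\<omega>. max 0 (X \<omega> - x) \<partial>M)"
proof -
  have q: "set_integrable lborel {a<..<1} (quantile X)" using X a by (intro set_integrable_quantile) auto
  have "(\<integral>\<omega>. max 0 (X \<omega> - x) \<partial>M) = (LBINT u:{0<..<1}. max 0 (quantile X u - x))"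
    using integral_quantile(2)[OF borel_measurable_integrable[OF X], of "\<lambda>y. max 0 (y - x)"] by simp
  also have "\<dots> = (LBINT u:{a<..<1}. quantile X u - x)"
    unfolding set_lebesgue_integral_def
  proof (rule Bochner_Integration.integral_cong)
    fix u :: real
    show "indicat_real {0<..<1} u *\<^sub>R max 0 (quantile X u - x) = indicat_real {a<..<1} u *\<^sub>R (quantile X u - x)"
      using X a quantile_mono[of X u a] quantile_mono[of X a u]
      by (cases "u \<le> a") (auto simp: indicator_def x_def max_def)
  qed simp
  also have "\<dots> = (LBINT u:{a<..<1}. quantile X u) - (LBINT u:{a<..<1}. x)"
    using q by (intro set_integral_diff(2) set_integrable_const_Ioo)
  finally show ?thesis using a by (simp add: set_integral_const_Ioo)
qed

text \<open>For \<open>a > 0\<close> the formula is exact for \<open>X\<close> and \<open>Y\<close>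
  at their quantiles \<open>x\<close> and \<open>y\<close>, and the positive part is convex. For
  \<open>a = 0\<close> the tail integral is the expectation, which is linear.\<close>

lemma tail_integral_convex:
  assumes X: "integrable M X" and Y: "integrable M Y" and a: "0 \<le> a" "a < 1" and g: "0 \<le> \<gamma>" "\<gamma> \<le> 1"
  defines "Z \<equiv> \<lambda>\<omega>. \<gamma> * X \<omega> + (1 - \<gamma>) * Y \<omega>"
  shows "(LBINT u:{a<..<1}. quantile Z u) \<le>
    \<gamma> * (LBINT u:{a<..<1}. quantile X u) + (1 - \<gamma>) * (LBINT u:{a<..<1}. quantile Y u)"
proof (cases "a = 0")
  case True
  have E: "(LBINT u:{0<..<1}. quantile W u) = (\<integral>\<omega>. W \<omega> \<partial>M)" if "integrable M W" for W
    using integral_quantile(2)[OF borel_measurable_integrable[OF that], of "\<lambda>y. y"] by simp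
  have "integrable M Z" unfolding Z_def using X Y by auto
  then show ?thesis using X Y by (simp add: True E Z_def)
next
  case False
  with a have a: "0 < a" "a < 1" by auto
  define x where "x = quantile X a"
  define y where "y = quantile Y a"
  \<comment> \<open>In general not the quantile of \<open>Z\<close>; an arbitrary point suffices for
    \<open>tail_integral_le\<close>.\<close>
  define z where "z = \<gamma> * x + (1 - \<gamma>) * y"
  have Z: "integrable M Z" unfolding Z_def using X Y by auto
  have "(\<integral>\<omega>. max 0 (Z \<omega> - z) \<partial>M) \<le> (\<integral>\<omega>. \<gamma> * max 0 (X \<omega> - x) + (1 - \<gamma>) * max 0 (Y \<omega> - y) \<partial>M)"
  proof (rule integral_mono)
    fix \<omega>
    have "Z \<omega> - z = \<gamma> * (X \<omega> - x) + (1 - \<gamma>) * (Y \<omega> - y)" by (simp add: Z_def z_def algebra_simps)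
    also have "\<dots> \<le> \<gamma> * max 0 (X \<omega> - x) + (1 - \<gamma>) * max 0 (Y \<omega> - y)"
      using g by (intro add_mono mult_left_mono) auto
    finally show "max 0 (Z \<omega> - z) \<le> \<gamma> * max 0 (X \<omega> - x) + (1 - \<gamma>) * max 0 (Y \<omega> - y)"
      using g by simp
  qed (use X Y Z in auto)
  also have "\<dots> = \<gamma> * (\<integral>\<omega>. max 0 (X \<omega> - x) \<partial>M) + (1 - \<gamma>) * (\<integral>\<omega>. max 0 (Y \<omega> - y) \<partial>M)"
    using X Y by simp
  finally have *: "(\<integral>\<omega>. max 0 (Z \<omega> - z) \<partial>M) \<le>
    \<gamma> * (\<integral>\<omega>. max 0 (X \<omega> - x) \<partial>M) + (1 - \<gamma>) * (\<integral>\<omega>. max 0 (Y \<omega> - y) \<partial>M)" .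
  have "(LBINT u:{a<..<1}. quantile Z u) \<le> (1 - a) * z + (\<integral>\<omega>. max 0 (Z \<omega> - z) \<partial>M)"
    using tail_integral_le[OF Z] a by simp
  also have "\<dots> \<le> (1 - a) * z + (\<gamma> * (\<integral>\<omega>. max 0 (X \<omega> - x) \<partial>M) + (1 - \<gamma>) * (\<integral>\<omega>. max 0 (Y \<omega> - y) \<partial>M))"
    using * by simp
  also have "\<dots> = \<gamma> * (LBINT u:{a<..<1}. quantile X u) + (1 - \<gamma>) * (LBINT u:{a<..<1}. quantile Y u)"
    unfolding tail_integral_eq[OF X a] tail_integral_eq[OF Y a] x_def[symmetric] y_def[symmetric] z_def
    by (simp add: algebra_simps)
  finally show ?thesis .
qed

lemma ES_quasi_convex:
  assumes X: "integrable M X" and Y: "integrable M Y" and a: "0 \<le> a" "a < 1" and g: "0 \<le> \<gamma>" "\<gamma> \<le> 1"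
  shows "ES M a (\<lambda>\<omega>. \<gamma> * X \<omega> + (1 - \<gamma>) * Y \<omega>) \<le> max (ES M a X) (ES M a Y)"
proof -
  let ?Z = "\<lambda>\<omega>. \<gamma> * X \<omega> + (1 - \<gamma>) * Y \<omega>"
  let ?t = "\<lambda>X. (LBINT u:{a<..<1}. quantile X u)"
  have Z: "integrable M ?Z" using X Y by auto
  have "?t ?Z \<le> \<gamma> * ?t X + (1 - \<gamma>) * ?t Y" by (rule tail_integral_convex[OF assms])
  also have "\<dots> \<le> max (?t X) (?t Y)" using g by (intro convex_bound_le) auto
  finally have "?t ?Z / (1 - a) \<le> max (?t X) (?t Y) / (1 - a)" using a by (intro divide_right_mono) auto
  also have "\<dots> = max (?t X / (1 - a)) (?t Y / (1 - a))" using a by (simp add: max_divide_distrib_right)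
  finally show ?thesis using X Y Z a by (simp add: ES_eq_quantile flip: ereal_max)
qed

text \<open>\<open>VaR M 1\<close> is the essential supremum: almost sure upper bounds
  \<open>x\<close> and \<open>y\<close> give the bound \<open>max x y\<close> for every convex
  combination. Any \<open>z\<close> above the right-hand side admits such bounds below it.\<close>

lemma VaR_1_quasi_convex:
  assumes [measurable]: "X \<in> borel_measurable M" "Y \<in> borel_measurable M" and g: "0 \<le> \<gamma>" "\<gamma> \<le> 1"
  shows "VaR M 1 (\<lambda>\<omega>. \<gamma> * X \<omega> + (1 - \<gamma>) * Y \<omega>) \<le> max (VaR M 1 X) (VaR M 1 Y)"
proof (rule dense_ge)
  fix z assume "max (VaR M 1 X) (VaR M 1 Y) < z"
  then obtain x y where xy: "ereal x < z" "prob {\<omega>\<in>space M. X \<omega> \<le> x} \<ge> 1"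
    "ereal y < z" "prob {\<omega>\<in>space M. Y \<omega> \<le> y} \<ge> 1"
    unfolding VaR_def by (auto simp: Inf_less_iff)
  then have "prob {\<omega>\<in>space M. X \<omega> \<le> x} = 1" "prob {\<omega>\<in>space M. Y \<omega> \<le> y} = 1"
    by (auto intro: antisym)
  then have "AE \<omega> in M. X \<omega> \<le> x" "AE \<omega> in M. Y \<omega> \<le> y" by (simp_all add: prob_Collect_eq_1)
  then have "AE \<omega> in M. \<gamma> * X \<omega> + (1 - \<gamma>) * Y \<omega> \<le> max x y"
    by eventually_elim (use g in \<open>auto intro!: convex_bound_le\<close>)
  then have "prob {\<omega>\<in>space M. \<gamma> * X \<omega> + (1 - \<gamma>) * Y \<omega> \<le> max x y} = 1"
    by (simp add: prob_Collect_eq_1)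
  then have "VaR M 1 (\<lambda>\<omega>. \<gamma> * X \<omega> + (1 - \<gamma>) * Y \<omega>) \<le> ereal (max x y)"
    unfolding VaR_def by (intro Inf_lower) (auto simp del: ereal_max)
  also have "\<dots> \<le> z" using xy by (auto simp: max_def)
  finally show "VaR M 1 (\<lambda>\<omega>. \<gamma> * X \<omega> + (1 - \<gamma>) * Y \<omega>) \<le> z" .
qed

lemma VaR_law_invariant:
  assumes "X \<in> borel_measurable M" "Y \<in> borel_measurable M" "distr M borel X = distr M borel Y"
  shows "VaR M a X = VaR M a Y"
  using assms cdf_distr_eq[of X] cdf_distr_eq[of Y] by (simp add: VaR_def)

lemma ES_law_invariant:
  assumes "X \<in> borel_measurable M" "Y \<in> borel_measurable M" "distr M borel X = distr M borel Y"
  shows "ES M a X = ES M a Y"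
  using VaR_law_invariant[OF assms] by (simp add: ES_def)

subsection \<open>Minimality\<close>

text \<open>Induction on the number of terms: the average of n + 2 variables is a convex
  combination, with weight (n + 1) / (n + 2), of the average of the first n + 1 and the last
  one.\<close>

lemma quasi_convex_on_average:
  fixes Y :: "nat \<Rightarrow> 'a \<Rightarrow> real"
  assumes qc: "quasi_convex_on D \<rho>"
    and D: "\<And>X Y \<gamma>. X \<in> D \<Longrightarrow> Y \<in> D \<Longrightarrow> 0 \<le> \<gamma> \<Longrightarrow> \<gamma> \<le> 1 \<Longrightarrow> (\<lambda>\<omega>. \<gamma> * X \<omega> + (1 - \<gamma>) * Y \<omega>) \<in> D"
    and Y: "\<And>i. Y i \<in> D" "\<And>i. \<rho> (Y i) \<le> r"
  shows "(\<lambda>\<omega>. (\<Sum>i<Suc n. Y i \<omega>) / Suc n) \<in> D \<and> \<rho> (\<lambda>\<omega>. (\<Sum>i<Suc n. Y i \<omega>) / Suc n) \<le> r"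
proof (induction n)
  case 0
  then show ?case using Y by simp
next
  case (Suc n)
  define \<gamma> where "\<gamma> = real (Suc n) / Suc (Suc n)"
  have g: "0 \<le> \<gamma>" "\<gamma> \<le> 1" by (auto simp: \<gamma>_def)
  define A where "A = (\<lambda>\<omega>. (\<Sum>i<Suc n. Y i \<omega>) / Suc n)"
  have A: "A \<in> D" "\<rho> A \<le> r" using Suc by (auto simp: A_def)
  have "\<gamma> * A \<omega> = (\<Sum>i<Suc n. Y i \<omega>) / Suc (Suc n)" for \<omega>
    by (simp add: A_def \<gamma>_def del: sum.lessThan_Suc of_nat_Suc)
  moreover have "1 - \<gamma> = 1 / Suc (Suc n)"
    by (simp add: \<gamma>_def field_simps)
  ultimately have "\<gamma> * A \<omega> + (1 - \<gamma>) * Y (Suc n) \<omega> = (\<Sum>i<Suc (Suc n). Y i \<omega>) / Suc (Suc n)" for \<omega>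
    by (simp add: add_divide_distrib sum.lessThan_Suc[of _ "Suc n"] del: sum.lessThan_Suc of_nat_Suc)
  then have "(\<lambda>\<omega>. (\<Sum>i<Suc (Suc n). Y i \<omega>) / Suc (Suc n)) = (\<lambda>\<omega>. \<gamma> * A \<omega> + (1 - \<gamma>) * Y (Suc n) \<omega>)"
    by (simp add: fun_eq_iff)
  moreover have "\<rho> (\<lambda>\<omega>. \<gamma> * A \<omega> + (1 - \<gamma>) * Y (Suc n) \<omega>) \<le> max (\<rho> A) (\<rho> (Y (Suc n)))"
    using qc A Y g unfolding quasi_convex_on_def by blast
  then have "\<rho> (\<lambda>\<omega>. \<gamma> * A \<omega> + (1 - \<gamma>) * Y (Suc n) \<omega>) \<le> r"
    using A Y by (meson max.bounded_iff order_trans max.boundedI)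
  ultimately show ?case using D[OF A(1) Y(1) g, of "Suc n"] by simp
qed

lemma quantile_integral_split:
  assumes X: "integrable M X" and "0 \<le> a" "a \<le> b" "b \<le> c" "c \<le> 1"
  shows "(LBINT u:{a<..<c}. quantile X u) = (LBINT u:{a<..<b}. quantile X u) + (LBINT u:{b<..<c}. quantile X u)"
proof -
  have "(LBINT u:{a<..<c}. quantile X u) = (LBINT u:{a<..<b} \<union> {b<..<c}. quantile X u)"
    using assms by (intro set_integral_discrete_difference[where X = "{b}"]) auto
  also have "\<dots> = (LBINT u:{a<..<b}. quantile X u) + (LBINT u:{b<..<c}. quantile X u)"
    using assms by (intro set_integral_Un set_integrable_quantile[OF X]) auto
  finally show ?thesis .
qed

text \<open>By monotonicity the integral over each interval is at most \<open>h\<close> times the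
  value at its right end. This right end is the left end of the next interval, so the sum is a lower
  sum shifted by one. The strict bound on \<open>a + m * h\<close> keeps all evaluation points
  inside (0, 1).\<close>

lemma lower_Riemann_sum:
  fixes m :: nat and a h :: real
  assumes X: "integrable M X" and a: "0 \<le> a" and h: "0 < h" "a + m * h < 1"
  shows "(LBINT u:{a<..<a + m * h}. quantile X u) \<le> h * (\<Sum>j<m. quantile X (a + (j + 1) * h))"
  using h(2)
proof (induction m)
  case (Suc m)
  let ?q = "quantile X"
  have mh: "a + m * h < 1" and m0: "0 \<le> m * h" using Suc.prems h(1) by (auto simp: algebra_simps)
  have "?q u \<le> ?q (a + Suc m * h)" if "u \<in> {a + m * h<..<a + Suc m * h}" for u
    using X a m0 Suc.prems that by (intro quantile_mono) auto
  then have "(LBINT u:{a + m * h<..<a + Suc m * h}. ?q u) \<le> (LBINT u:{a + m * h<..<a + Suc m * h}. ?q (a + Suc m * h))"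
    using a m0 Suc.prems
    by (intro set_integral_mono set_integrable_const_Ioo set_integrable_quantile[OF X]) auto
  also have "\<dots> = h * ?q (a + Suc m * h)" using h by (simp add: set_integral_const_Ioo algebra_simps)
  finally have "(LBINT u:{a + m * h<..<a + Suc m * h}. ?q u) \<le> h * ?q (a + Suc m * h)" .
  moreover have "(LBINT u:{a<..<a + Suc m * h}. ?q u) =
      (LBINT u:{a<..<a + m * h}. ?q u) + (LBINT u:{a + m * h<..<a + Suc m * h}. ?q u)"
    using a m0 h(1) Suc.prems by (intro quantile_integral_split[OF X]) (auto simp: algebra_simps)
  ultimately show ?case using Suc.IH[OF mh] by (simp add: algebra_simps)
qed (simp add: set_lebesgue_integral_def)

text \<open>The variables are the quantiles along the orbit of \<open>U\<close> under the cyclic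
  shift. Left-end values bound them from below, except on the first interval: its left end
  \<open>a\<close> may be 0, so \<open>c\<close> takes over there. The index shift of the lower sum
  makes the integral stop one interval short of 1.\<close>

lemma exists_rearrangements:
  assumes "atomless M" and X: "integrable M X" and a: "0 \<le> a" "a < 1" and n: "0 < n"
    and c: "\<And>u. a < u \<Longrightarrow> u < 1 \<Longrightarrow> c \<le> quantile X u"
  obtains Y :: "nat \<Rightarrow> 'a \<Rightarrow> real" where
    "\<And>i. Y i \<in> borel_measurable M" "\<And>i. distr M borel (Y i) = distr M borel X"
    "ereal (c / n + (LBINT u:{a<..<1 - (1 - a) / n}. quantile X u) / (1 - a)) \<le>
      VaR_plus M a (\<lambda>\<omega>. (\<Sum>i<n. Y i \<omega>) / n)"
proof -
  have Xm [measurable]: "X \<in> borel_measurable M" using X by simp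
  define h where "h = (1 - a) / n"
  have h: "0 < h" "real n * h = 1 - a" using a n by (auto simp: h_def)
  have "1 * h \<le> real n * h" using n h by (intro mult_right_mono) auto
  then have ah: "a + h \<le> 1" using h(2) by linarith
  obtain U where U: "uniform_rv U" using atomless_uniform_rv[OF assms(1)] .
  define V where "V i \<omega> = (cyclic_shift a h ^^ i) (U \<omega>)" for i \<omega>
  have V: "uniform_rv (V i)" for i
    unfolding V_def using uniform_rv_funpow_cyclic_shift[OF U a(1) h(1) ah] .
  have [measurable]: "V i \<in> borel_measurable M" "U \<in> borel_measurable M" for i
    using V U by (auto simp: uniform_rv_def)
  define Y where "Y i \<omega> = quantile X (V i \<omega>)" for i \<omega>
  have Ym [measurable]: "Y i \<in> borel_measurable M" for i
    unfolding Y_def using measurable_quantile[OF Xm] by measurable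
  have Yd: "distr M borel (Y i) = distr M borel X" for i
    unfolding Y_def by (rule distr_quantile_uniform_rv[OF Xm V])
  define L where "L = c / n + (LBINT u:{a<..<1 - h}. quantile X u) / (1 - a)"
  have low: "L \<le> (\<Sum>i<n. Y i \<omega>) / n" if \<omega>: "\<And>i. 0 < V i \<omega> \<and> V i \<omega> < 1" "a < U \<omega>" for \<omega>
  proof -
    define u where "u = U \<omega>"
    have u: "a < u" "u < 1" using \<omega>(1)[of 0] \<omega>(2) by (auto simp: u_def V_def)
    \<comment> \<open>The intervals are closed on the right, so the index of the one containing
      \<open>u\<close> is a ceiling minus 1.\<close>
    define z where "z = \<lceil>(u - a) / h\<rceil>"
    have "0 < (u - a) / h" using u h by simp
    then have z: "1 \<le> z" unfolding z_def by linarith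
    define k where "k = nat (z - 1)"
    have "real k + 1 = z" using z by (simp add: k_def)
    then have k1: "(u - a) / h \<le> real k + 1" "real k < (u - a) / h"
      unfolding z_def by linarith+
    then have k2: "u \<le> a + (k + 1) * h" "a + k * h < u" using h by (auto simp: field_simps)
    have "(u - a) / h < n" using h u by (simp add: field_simps)
    then have kn: "k < n" using k1 by linarith
    define l where "l i = (k + i) mod n" for i
    \<comment> \<open>A lower bound for the quantile function on interval \<open>j\<close>.\<close>
    define g where "g j = (if j = 0 then c else quantile X (a + j * h))" for j :: nat
    have "g (l i) \<le> Y i \<omega>" for i
    proof -
      have "a + l i * h < V i \<omega>"
        using funpow_cyclic_shift[OF h kn k2(2,1), of i] by (simp add: l_def V_def u_def)
      moreover have "0 \<le> l i * h" "0 < l i \<Longrightarrow> 0 < l i * h" using h by simp_all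
      ultimately show ?thesis using \<omega>(1)[of i] a c quantile_mono[OF Xm, of "a + l i * h" "V i \<omega>"]
        by (auto simp: g_def Y_def)
    qed
    then have "(\<Sum>i<n. g (l i)) \<le> (\<Sum>i<n. Y i \<omega>)" by (rule sum_mono)
    \<comment> \<open>The orbit visits each interval exactly once, so the bounds sum to the same
      total whatever the starting interval \<open>k\<close>.\<close>
    moreover have "bij_betw l {..<n} {..<n}"
    proof -
      have "l i = (if k + i < n then k + i else k + i - n)" if "i < n" for i
        using that kn by (simp add: l_def mod_if)
      then have "inj_on l {..<n}" using kn by (auto intro!: inj_onI split: if_splits)
      moreover have "l ` {..<n} \<subseteq> {..<n}" using n by (auto simp: l_def)
      ultimately show ?thesis by (simp add: bij_betw_def endo_inj_surj)
    qed
    then have "(\<Sum>i<n. g (l i)) = (\<Sum>j<n. g j)" by (rule sum.reindex_bij_betw)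
    moreover have "(\<Sum>j<n. g j) = c + (\<Sum>j<n - 1. quantile X (a + (j + 1) * h))"
    proof -
      have "(\<Sum>j<n. g j) = (\<Sum>j<Suc (n - 1). g j)" using n by simp
      then show ?thesis unfolding sum.lessThan_Suc_shift by (simp add: g_def add.commute)
    qed
    moreover have "(LBINT u:{a<..<1 - h}. quantile X u) / h \<le> (\<Sum>j<n - 1. quantile X (a + (j + 1) * h))"
    proof -
      have "a + real (n - 1) * h = 1 - h" using h n by (simp add: of_nat_diff algebra_simps)
      then show ?thesis using lower_Riemann_sum[OF X a(1) h(1), of "n - 1"] h by (simp add: divide_le_eq mult.commute)
    qed
    ultimately have "c + (LBINT u:{a<..<1 - h}. quantile X u) / h \<le> (\<Sum>i<n. Y i \<omega>)"
      by linarith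
    then have "(c + (LBINT u:{a<..<1 - h}. quantile X u) / h) / n \<le> (\<Sum>i<n. Y i \<omega>) / n"
      by (rule divide_right_mono) simp
    moreover have "(c + (LBINT u:{a<..<1 - h}. quantile X u) / h) / n = L"
      using h n by (simp add: L_def h(2)[symmetric] add_divide_distrib mult.commute)
    ultimately show ?thesis by simp
  qed
  have AE: "AE \<omega> in M. \<forall>i. 0 < V i \<omega> \<and> V i \<omega> < 1"
    using uniform_rv_AE[OF V] by (simp add: AE_all_countable)
  have "ereal L \<le> VaR_plus M a (\<lambda>\<omega>. (\<Sum>i<n. Y i \<omega>) / n)"
    unfolding VaR_plus_def
  proof (rule Inf_greatest, clarify)
    fix x assume x: "a < prob {\<omega>\<in>space M. (\<Sum>i<n. Y i \<omega>) / n \<le> x}"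
    show "ereal L \<le> ereal x"
    proof (rule ccontr)
      assume "\<not> ereal L \<le> ereal x"
      then have "x < L" by simp
      \<comment> \<open>By \<open>low\<close>, an average below \<open>L\<close> forces
        \<open>U \<omega> \<le> a\<close> almost surely, an event of probability only
        \<open>a\<close>.\<close>
      have "prob {\<omega>\<in>space M. (\<Sum>i<n. Y i \<omega>) / n \<le> x} \<le> prob {\<omega>\<in>space M. U \<omega> \<le> a}"
        using AE
      proof (intro finite_measure_mono_AE, eventually_elim, clarify)
        fix \<omega> assume "\<forall>i. 0 < V i \<omega> \<and> V i \<omega> < 1" "(\<Sum>i<n. Y i \<omega>) / n \<le> x"
        then show "U \<omega> \<le> a" using low[of \<omega>] \<open>x < L\<close> by fastforce
      qed auto
      also have "\<dots> = a" using U a by (simp add: uniform_rv_def)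
      finally show False using x by simp
    qed
  qed
  then show thesis using Ym Yd by (intro that[of Y]) (auto simp: L_def h_def)
qed

text \<open>Averages of rearrangements bound \<rho> X from below for each number of intervals, and
  the bounds converge to the expected shortfall. The domain is kept abstract, with the closure
  properties as hypotheses, to serve both spaces.\<close>

lemma ES_le_dominating:
  assumes atl: "atomless M" and X: "integrable M X" "X \<in> D" and a: "0 \<le> a" "a < 1"
    and cvx: "\<And>X Y \<gamma>. X \<in> D \<Longrightarrow> Y \<in> D \<Longrightarrow> 0 \<le> \<gamma> \<Longrightarrow> \<gamma> \<le> 1 \<Longrightarrow> (\<lambda>\<omega>. \<gamma> * X \<omega> + (1 - \<gamma>) * Y \<omega>) \<in> D"
    and law: "\<And>Y. Y \<in> borel_measurable M \<Longrightarrow> distr M borel Y = distr M borel X \<Longrightarrow> Y \<in> D"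
    and \<rho>: "\<rho> \<in> dominating_qc_li M D (VaR_plus M a)"
    and c: "\<And>u. a < u \<Longrightarrow> u < 1 \<Longrightarrow> c \<le> quantile X u"
  shows "ES M a X \<le> \<rho> X"
proof -
  let ?I = "\<lambda>A. (LBINT u:A. quantile X u)"
  have bound: "ereal (c / Suc n + ?I {a<..<1 - (1 - a) / Suc n} / (1 - a)) \<le> \<rho> X" for n
  proof -
    obtain Y :: "nat \<Rightarrow> 'a \<Rightarrow> real" where Y: "\<And>i. Y i \<in> borel_measurable M" "\<And>i. distr M borel (Y i) = distr M borel X"
      "ereal (c / Suc n + ?I {a<..<1 - (1 - a) / Suc n} / (1 - a)) \<le>
      VaR_plus M a (\<lambda>\<omega>. (\<Sum>i<Suc n. Y i \<omega>) / Suc n)"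
      by (rule exists_rearrangements[OF atl X(1) a zero_less_Suc[of n] c]) (assumption | rule that)+
    have YD: "Y i \<in> D" for i using law Y by simp
    have "\<rho> (Y i) \<le> \<rho> X" for i
      using \<rho> YD X(2) Y(2)[of i] unfolding dominating_qc_li_def law_invariant_on_def
      by (metis (mono_tags, lifting) mem_Collect_eq order_refl)
    moreover have "quasi_convex_on D \<rho>" using \<rho> by (simp add: dominating_qc_li_def)
    ultimately have "(\<lambda>\<omega>. (\<Sum>i<Suc n. Y i \<omega>) / Suc n) \<in> D \<and> \<rho> (\<lambda>\<omega>. (\<Sum>i<Suc n. Y i \<omega>) / Suc n) \<le> \<rho> X"
      using cvx YD by (intro quasi_convex_on_average)
    moreover from this have "VaR_plus M a (\<lambda>\<omega>. (\<Sum>i<Suc n. Y i \<omega>) / Suc n) \<le> \<rho> (\<lambda>\<omega>. (\<Sum>i<Suc n. Y i \<omega>) / Suc n)"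
      using \<rho> unfolding dominating_qc_li_def by blast
    ultimately show ?thesis using Y(3) by (meson order_trans)
  qed
  have lim0: "(\<lambda>n. r / real (Suc n)) \<longlonglongrightarrow> 0" for r :: real
    using tendsto_mult[OF tendsto_const[of r] LIMSEQ_inverse_real_of_nat] by (simp add: divide_inverse)
  \<comment> \<open>These intervals increase to (a, 1), so the truncated integrals converge to the
    full tail integral.\<close>
  define A where "A n = {a<..<1 - (1 - a) / Suc n}" for n
  have un: "(\<Union>n. A n) = {a<..<1}"
  proof (intro equalityI subsetI)
    fix u assume u: "u \<in> {a<..<1}"
    have "\<forall>\<^sub>F n in sequentially. (1 - a) / Suc n < 1 - u"
      using u by (intro order_tendstoD(2)[OF lim0]) auto
    then obtain n where "(1 - a) / Suc n < 1 - u" by (auto simp: eventually_sequentially)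
    then show "u \<in> (\<Union>n. A n)" using u by (auto simp: A_def intro!: exI[of _ n])
  next
    fix u assume "u \<in> (\<Union>n. A n)"
    then obtain n where "u \<in> A n" by auto
    moreover have "0 \<le> (1 - a) / Suc n" using a by simp
    ultimately show "u \<in> {a<..<1}" unfolding A_def by auto
  qed
  have "incseq A"
  proof (rule incseq_SucI)
    fix n
    have "(1 - a) / Suc (Suc n) \<le> (1 - a) / Suc n" using a by (intro divide_left_mono) auto
    then show "A n \<subseteq> A (Suc n)" unfolding A_def by auto
  qed
  moreover have "set_integrable lborel (\<Union>n. A n) (quantile X)"
    unfolding un using a by (intro set_integrable_quantile[OF X(1)]) auto
  moreover have "A n \<in> sets lborel" for n by (simp add: A_def)
  ultimately have "(\<lambda>n. ?I (A n)) \<longlonglongrightarrow> ?I (\<Union>n. A n)"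
    by (intro set_integral_cont_up) auto
  then have "(\<lambda>n. c / Suc n + ?I (A n) / (1 - a)) \<longlonglongrightarrow> 0 + ?I {a<..<1} / (1 - a)"
    unfolding un using a by (intro tendsto_intros lim0) auto
  then have "(\<lambda>n. ereal (c / Suc n + ?I (A n) / (1 - a))) \<longlonglongrightarrow> ES M a X"
    using ES_eq_quantile[OF X(1) a] by simp
  then show ?thesis using bound by (intro LIMSEQ_le_const2) (auto simp: A_def)
qed

lemma dominating_qc_li_mono:
  assumes "\<rho> \<in> dominating_qc_li M D g" "\<And>X. f X \<le> g X"
  shows "\<rho> \<in> dominating_qc_li M D f"
proof -
  have "f X \<le> \<rho> X" if "X \<in> D" for X
    using assms that order_trans[OF assms(2)[of X], of "\<rho> X"] by (simp add: dominating_qc_li_def)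
  then show ?thesis using assms(1) by (simp add: dominating_qc_li_def)
qed

section \<open>Closure of the two domains under convex combinations and equality in law\<close>

lemma L1_bdd_below_subset: "L1_bdd_below M \<subseteq> L1 M"
  unfolding L1_def L1_bdd_below_def by blast

lemma L1_convex:
  assumes "X \<in> L1 M" "Y \<in> L1 M"
  shows "(\<lambda>\<omega>. \<gamma> * X \<omega> + (1 - \<gamma>) * Y \<omega>) \<in> L1 M"
  using assms by (auto simp: L1_def)

lemma L1_law_invariant:
  assumes "X \<in> L1 M" "Y \<in> borel_measurable M" "distr M borel Y = distr M borel X"
  shows "Y \<in> L1 M"
proof -
  have X: "integrable M X" using assms(1) by (simp add: L1_def)
  then have "integrable (distr M borel X) (\<lambda>x. x)"
    by (subst integrable_distr_eq) simp_all
  then have "integrable (distr M borel Y) (\<lambda>x. x)" by (simp only: assms(3))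
  then have "integrable M Y" by (subst (asm) integrable_distr_eq) (use assms(2) in simp_all)
  then show ?thesis by (simp add: L1_def)
qed

lemma L1_bdd_below_convex:
  assumes "X \<in> L1_bdd_below M" "Y \<in> L1_bdd_below M" "0 \<le> \<gamma>" "\<gamma> \<le> 1"
  shows "(\<lambda>\<omega>. \<gamma> * X \<omega> + (1 - \<gamma>) * Y \<omega>) \<in> L1_bdd_below M"
proof -
  obtain c d where cd: "AE \<omega> in M. c \<le> X \<omega>" "AE \<omega> in M. d \<le> Y \<omega>"
    using assms by (auto simp: L1_bdd_below_def)
  then have "AE \<omega> in M. \<gamma> * c + (1 - \<gamma>) * d \<le> \<gamma> * X \<omega> + (1 - \<gamma>) * Y \<omega>"
    by eventually_elim (use assms in \<open>auto intro!: add_mono mult_left_mono\<close>)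
  then show ?thesis using assms by (auto simp: L1_bdd_below_def)
qed

lemma L1_bdd_below_law_invariant:
  assumes X: "X \<in> L1_bdd_below M" and Y: "Y \<in> borel_measurable M" and eq: "distr M borel Y = distr M borel X"
  shows "Y \<in> L1_bdd_below M"
proof -
  have XL: "X \<in> L1 M" using X by (auto simp: L1_def L1_bdd_below_def)
  then have Xm: "X \<in> borel_measurable M" by (auto simp: L1_def)
  obtain c where "AE \<omega> in M. c \<le> X \<omega>" using X by (auto simp: L1_bdd_below_def)
  then have "AE x in distr M borel X. c \<le> x" using Xm by (simp add: AE_distr_iff)
  then have "AE x in distr M borel Y. c \<le> x" by (simp only: eq)
  then have "AE \<omega> in M. c \<le> Y \<omega>" by (subst (asm) AE_distr_iff) (use Y in auto)
  then show ?thesis using L1_law_invariant[OF XL Y eq] by (auto simp: L1_def L1_bdd_below_def)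
qed

text \<open>Otherwise \<open>X\<close> would almost surely exceed its quantile at \<open>u\<close>,
  whereas it stays at or below it with probability at least \<open>u\<close>. This supplies the
  constant \<open>c\<close> when the level may be 0.\<close>

lemma AE_ge_quantile_ge:
  assumes X [measurable]: "X \<in> borel_measurable M" and c: "AE \<omega> in M. c \<le> X \<omega>" and u: "0 < u" "u < 1"
  shows "c \<le> quantile X u"
proof (rule ccontr)
  assume "\<not> c \<le> quantile X u"
  with c have "AE \<omega> in M. \<not> X \<omega> \<le> quantile X u" by (auto elim!: eventually_mono)
  then have "prob {\<omega>\<in>space M. X \<omega> \<le> quantile X u} = 0" by (simp add: prob_Collect_eq_0)
  then show False using quantile_le_iff[OF X u, of "quantile X u"] u by simp
qed

text \<open>At each level \<open>b < a\<close> the map dominates the upper quantile, hence the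
  expected shortfall at \<open>b\<close>; then \<open>b\<close> increases to
  \<open>a\<close>.\<close>

lemma ES_le_dominating_VaR:
  assumes atl: "atomless M" and X: "X \<in> L1 M" and a: "0 < a" "a < 1"
    and \<rho>: "\<rho> \<in> dominating_qc_li M (L1 M) (VaR M a)"
  shows "ES M a X \<le> \<rho> X"
proof -
  have int: "integrable M X" using X by (simp add: L1_def)
  let ?I = "\<lambda>b. (LBINT u:{b<..<1}. quantile X u)"
  \<comment> \<open>A lower bound for the quantiles at levels in (b, a) once
    \<open>b > a / 2\<close>. It replaces the integral over (b, a) by an explicit term that visibly
    vanishes as \<open>b\<close> tends to \<open>a\<close>.\<close>
  define q where "q = quantile X (a / 2)"
  have *: "ereal ((?I a + (a - b) * q) / (1 - b)) \<le> \<rho> X" if b: "a / 2 < b" "b < a" for b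
  proof -
    have dom: "\<rho> \<in> dominating_qc_li M (L1 M) (VaR_plus M b)"
      using \<rho> VaR_plus_le_VaR[OF b(2)] by (rule dominating_qc_li_mono)
    have le: "ES M b X \<le> \<rho> X"
    proof (rule ES_le_dominating[OF atl int X _ _ L1_convex L1_law_invariant[OF X] dom])
      show "quantile X b \<le> quantile X u" if "b < u" "u < 1" for u
        using a b that int by (intro quantile_mono) auto
    qed (assumption | (use a b in simp))+
    have sub: "set_integrable lborel {s<..<t} (quantile X)" if "b \<le> s" "t \<le> 1" for s t
      using a b that by (intro set_integrable_quantile[OF int]) auto
    have "(LBINT u:{b<..<a}. q) \<le> (LBINT u:{b<..<a}. quantile X u)"
      using a b int by (intro set_integral_mono set_integrable_const_Ioo sub) (auto simp: q_def quantile_mono)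
    then have "?I a + (a - b) * q \<le> ?I b"
      using a b quantile_integral_split[OF int, of b a 1] by (simp add: set_integral_const_Ioo)
    then have "(?I a + (a - b) * q) / (1 - b) \<le> ?I b / (1 - b)"
      using a b by (intro divide_right_mono) auto
    then have "ereal ((?I a + (a - b) * q) / (1 - b)) \<le> ES M b X"
      using a b by (simp add: ES_eq_quantile[OF int])
    also note le
    finally show ?thesis .
  qed
  have "((\<lambda>b. (?I a + (a - b) * q) / (1 - b)) \<longlongrightarrow> (?I a + (a - a) * q) / (1 - a)) (at_left a)"
    using a by (intro tendsto_divide tendsto_add tendsto_mult tendsto_diff tendsto_const tendsto_ident_at) auto
  then have "((\<lambda>b. ereal ((?I a + (a - b) * q) / (1 - b))) \<longlongrightarrow> ES M a X) (at_left a)"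
    using a by (simp add: ES_eq_quantile[OF int])
  moreover have "\<forall>\<^sub>F b in at_left a. ereal ((?I a + (a - b) * q) / (1 - b)) \<le> \<rho> X"
    using * a unfolding eventually_at_left_field by (intro exI[of _ "a / 2"]) auto
  ultimately show ?thesis by (intro tendsto_upperbound) auto
qed

section \<open>Membership of the expected shortfall, and the three minima\<close>

lemma ES_mem_dominating:
  assumes D: "D \<subseteq> L1 M" and a: "0 \<le> a" "a < 1"
  shows "ES M a \<in> dominating_qc_li M D (VaR_plus M a)"
proof -
  have L: "integrable M X" if "X \<in> D" for X using D that by (auto simp: L1_def)
  show ?thesis
    unfolding dominating_qc_li_def quasi_convex_on_def law_invariant_on_def
  proof (intro CollectI conjI ballI allI impI)
    fix X Y assume XY: "X \<in> D" "Y \<in> D"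
    show "ES M a (\<lambda>\<omega>. \<gamma> * X \<omega> + (1 - \<gamma>) * Y \<omega>) \<le> max (ES M a X) (ES M a Y)"
      if "0 \<le> \<gamma> \<and> \<gamma> \<le> 1" for \<gamma>
      using ES_quasi_convex[OF L[OF XY(1)] L[OF XY(2)] a] that by blast
    show "ES M a X = ES M a Y" if "distr M borel X = distr M borel Y"
      using L[OF XY(1)] L[OF XY(2)] that by (intro ES_law_invariant borel_measurable_integrable)
  qed (rule VaR_plus_le_ES[OF L a])
qed

lemma VaR_1_mem_dominating: "VaR M 1 \<in> dominating_qc_li M (L1 M) (VaR M 1)"
  unfolding dominating_qc_li_def quasi_convex_on_def law_invariant_on_def
proof (intro CollectI conjI ballI allI impI)
  fix X Y assume XY: "X \<in> L1 M" "Y \<in> L1 M"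
  then have meas: "X \<in> borel_measurable M" "Y \<in> borel_measurable M" by (simp_all add: L1_def)
  show "VaR M 1 (\<lambda>\<omega>. \<gamma> * X \<omega> + (1 - \<gamma>) * Y \<omega>) \<le> max (VaR M 1 X) (VaR M 1 Y)"
    if "0 \<le> \<gamma> \<and> \<gamma> \<le> 1" for \<gamma>
    using VaR_1_quasi_convex[OF meas] that by blast
  show "VaR M 1 X = VaR M 1 Y" if "distr M borel X = distr M borel Y"
    using VaR_law_invariant[OF meas that] .
qed simp

lemma ES_is_min_on:
  assumes "atomless M"
  shows "(\<forall>\<alpha>\<in>{0<..1}. is_min_on (L1 M) (ES M \<alpha>) (dominating_qc_li M (L1 M) (VaR M \<alpha>)))
       \<and> (\<forall>\<alpha>\<in>{0<..<1}. is_min_on (L1 M) (ES M \<alpha>) (dominating_qc_li M (L1 M) (VaR_plus M \<alpha>)))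
       \<and> (\<forall>\<alpha>\<in>{0..<1}. is_min_on (L1_bdd_below M) (ES M \<alpha>)
              (dominating_qc_li M (L1_bdd_below M) (VaR_plus M \<alpha>)))"
proof (intro conjI ballI)
  fix a :: real assume a: "a \<in> {0<..1}"
  show "is_min_on (L1 M) (ES M a) (dominating_qc_li M (L1 M) (VaR M a))"
  proof (cases "a < 1")
    case True
    have "ES M a \<in> dominating_qc_li M (L1 M) (VaR_plus M a)"
      by (rule ES_mem_dominating) (use a True in simp_all)
    then have "ES M a \<in> dominating_qc_li M (L1 M) (VaR M a)"
      by (rule dominating_qc_li_mono) (rule VaR_le_VaR_plus)
    then show ?thesis
      using ES_le_dominating_VaR[OF assms] a True by (simp add: is_min_on_def)
  next
    case False
    \<comment> \<open>At level 1 the expected shortfall is \<open>VaR M 1\<close> by definition, so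
      minimality is the domination condition itself.\<close>
    then have "a = 1" using a by simp
    then have "ES M a = VaR M 1" by (simp add: ES_def fun_eq_iff)
    then show ?thesis using VaR_1_mem_dominating \<open>a = 1\<close>
      by (simp add: is_min_on_def) (simp add: dominating_qc_li_def)
  qed
next
  fix a :: real assume a: "a \<in> {0<..<1}"
  have "ES M a X \<le> \<rho> X" if \<rho>: "\<rho> \<in> dominating_qc_li M (L1 M) (VaR_plus M a)" and X: "X \<in> L1 M" for \<rho> X
  proof (rule ES_le_dominating[OF assms _ X _ _ L1_convex L1_law_invariant[OF X] \<rho>])
    show int: "integrable M X" using X by (simp add: L1_def)
    \<comment> \<open>As \<open>a > 0\<close>, the quantile at \<open>a\<close> serves as the lower
      bound on (a, 1).\<close>
    show "quantile X a \<le> quantile X u" if "a < u" "u < 1" for u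
      using a that int by (intro quantile_mono) auto
  qed (assumption | (use a in simp))+
  moreover have "ES M a \<in> dominating_qc_li M (L1 M) (VaR_plus M a)"
    by (rule ES_mem_dominating) (use a in simp_all)
  ultimately show "is_min_on (L1 M) (ES M a) (dominating_qc_li M (L1 M) (VaR_plus M a))"
    by (simp add: is_min_on_def)
next
  fix a :: real assume a: "a \<in> {0..<1}"
  have "ES M a X \<le> \<rho> X"
    if \<rho>: "\<rho> \<in> dominating_qc_li M (L1_bdd_below M) (VaR_plus M a)" and X: "X \<in> L1_bdd_below M" for \<rho> X
  proof -
    have int: "integrable M X" using X by (simp add: L1_bdd_below_def)
    obtain c where c: "AE \<omega> in M. c \<le> X \<omega>" using X by (auto simp: L1_bdd_below_def)
    show ?thesis
    proof (rule ES_le_dominating[OF assms int X _ _ L1_bdd_below_convex L1_bdd_below_law_invariant[OF X] \<rho>])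
      \<comment> \<open>Here \<open>a\<close> may be 0, and the essential lower bound of
        \<open>X\<close> takes the place of its quantile at \<open>a\<close>.\<close>
      show "c \<le> quantile X u" if "a < u" "u < 1" for u
        using a that int c by (intro AE_ge_quantile_ge) auto
    qed (assumption | (use a in simp))+
  qed
  moreover have "ES M a \<in> dominating_qc_li M (L1_bdd_below M) (VaR_plus M a)"
    by (rule ES_mem_dominating) (use a L1_bdd_below_subset in simp_all)
  ultimately show "is_min_on (L1_bdd_below M) (ES M a) (dominating_qc_li M (L1_bdd_below M) (VaR_plus M a))"
    by (simp add: is_min_on_def)
qed

end

theorem theorem5:
  fixes M :: "'a measure"
  assumes "prob_space M" and "atomless M"
  shows "(\<forall>\<alpha>\<in>{0<..1}. is_min_on (L1 M) (ES M \<alpha>) (dominating_qc_li M (L1 M) (VaR M \<alpha>)))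
       \<and> (\<forall>\<alpha>\<in>{0<..<1}. is_min_on (L1 M) (ES M \<alpha>) (dominating_qc_li M (L1 M) (VaR_plus M \<alpha>)))
       \<and> (\<forall>\<alpha>\<in>{0..<1}. is_min_on (L1_bdd_below M) (ES M \<alpha>)
              (dominating_qc_li M (L1_bdd_below M) (VaR_plus M \<alpha>)))"
  using assms by (rule prob_space.ES_is_min_on)

end
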